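(* Let $(M,g)$ be a smooth, compact, connected Riemannian manifold without boundary, let $\omega$ be an open subset of $M$ and let $V\in C^\infty(M,(0,\infty))$ satisfy $\|V\|_{L^\infty(M)}=1$. Assume that there is a critical point $x_0\in M$ of $V$ such that $x_0\notin\omega$. Then for any time $T>0$, $(\omega,T)$ does not satisfy (GCC$_V$).
   Context: For a smooth real function $k$ on $T^*M$, $\varphi^k_t$ denotes the flow of its Hamiltonian vector field $H_k=\sum_j \partial_{\xi_j}k\,\partial_{x_j}-\partial_{x_j}k\,\partial_{\xi_j}$ (canonical coordinates); $\pi_M:T^*M\to M$ is the canonical projection, $|\xi|_g$ the norm of a covector, and $q(x,\xi):=\sqrt{|\xi|_g^2+V(x)}$ on $T^*M$. For an open set $\omega\subset M$ and $T>0$, $(\omega,T)$ satisfies (GCC$_V$) if for every $\rho\in T^*M$ there is $t\in(0,T)$ with $\pi_M\circ\varphi_t^{q}(\rho)\in\omega$. *)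

theory Defs
  imports "HOL-Analysis.Analysis"
begin

section \<open>Smooth maps between Euclidean spaces\<close>

text \<open>Meant for open sets only.  Differentiability together with continuity of all
  directional derivatives is the usual \<open>C\<^sup>k\<close> condition in finite dimension.\<close>

primrec Ck_on :: "nat \<Rightarrow> 'a::euclidean_space set \<Rightarrow> ('a \<Rightarrow> 'b::real_normed_vector) \<Rightarrow> bool" where
  "Ck_on 0 S f \<longleftrightarrow> continuous_on S f"
| "Ck_on (Suc k) S f \<longleftrightarrow>
     (\<forall>x\<in>S. f differentiable (at x)) \<and> (\<forall>v. Ck_on k S (\<lambda>x. frechet_derivative f (at x) v))"

definition smooth_on :: "'a::euclidean_space set \<Rightarrow> ('a \<Rightarrow> 'b::real_normed_vector) \<Rightarrow> bool" where
  "smooth_on S f \<longleftrightarrow> (\<forall>k. Ck_on k S f)"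

section \<open>Smooth manifolds\<close>

text \<open>A chart is a pair of its domain and a coordinate map; the values of the coordinate map
  outside the domain are irrelevant.  The atlas need not be maximal: all notions below depend only
  on the smooth structure it generates.  The dimension of the manifold is \<open>DIM('e)\<close>.\<close>

type_synonym ('m, 'e) chart = "'m set \<times> ('m \<Rightarrow> 'e)"

abbreviation chart_inv :: "('m, 'e) chart \<Rightarrow> 'e \<Rightarrow> 'm" where
  "chart_inv c \<equiv> inv_into (fst c) (snd c)"

abbreviation chart_image :: "('m, 'e) chart \<Rightarrow> 'e set" where
  "chart_image c \<equiv> snd c ` fst c"

definition charts_at :: "('m, 'e) chart set \<Rightarrow> 'm \<Rightarrow> ('m, 'e) chart set" where
  "charts_at A p = {c \<in> A. p \<in> fst c}"

locale smooth_manifold =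
  fixes X :: "'m topology" and A :: "('m, 'e::euclidean_space) chart set"
  assumes Hausdorff: "Hausdorff_space X"
    and second_countable: "second_countable X"
    and cover: "topspace X = (\<Union>c\<in>A. fst c)"
    and chart_domain_open: "c \<in> A \<Longrightarrow> openin X (fst c)"
    and chart_image_open: "c \<in> A \<Longrightarrow> open (chart_image c)"
    and chart_homeomorphism:
      "c \<in> A \<Longrightarrow> homeomorphic_map (subtopology X (fst c)) (top_of_set (chart_image c)) (snd c)"
    and smooth_transition:
      "c \<in> A \<Longrightarrow> c' \<in> A \<Longrightarrow> smooth_on (snd c ` (fst c \<inter> fst c')) (snd c' \<circ> chart_inv c)"

definition smooth_fun :: "('m, 'e::euclidean_space) chart set \<Rightarrow> ('m \<Rightarrow> real) \<Rightarrow> bool" where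
  "smooth_fun A f \<longleftrightarrow> (\<forall>c\<in>A. smooth_on (chart_image c) (f \<circ> chart_inv c))"

definition critical_point ::
  "('m, 'e::euclidean_space) chart set \<Rightarrow> ('m \<Rightarrow> real) \<Rightarrow> 'm \<Rightarrow> bool" where
  "critical_point A f p \<longleftrightarrow>
     (\<forall>c\<in>charts_at A p. ((f \<circ> chart_inv c) has_derivative (\<lambda>_. 0)) (at (snd c p)))"

text \<open>The null sets of the Riemannian volume are the sets that are Lebesgue-null in charts
  (its density in a chart is smooth and positive), whatever the metric.\<close>

definition null_set :: "('m, 'e::euclidean_space) chart set \<Rightarrow> 'm set \<Rightarrow> bool" where
  "null_set A N \<longleftrightarrow> (\<forall>c\<in>A. negligible (snd c ` (N \<inter> fst c)))"

definition Linf_norm ::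
  "'m topology \<Rightarrow> ('m, 'e::euclidean_space) chart set \<Rightarrow> ('m \<Rightarrow> real) \<Rightarrow> real" where
  "Linf_norm X A f = Inf {C. 0 \<le> C \<and> null_set A {x \<in> topspace X. \<bar>f x\<bar> > C}}"

section \<open>Tangent and cotangent bundle\<close>

text \<open>A tangent vector at \<open>p\<close> is the family of its coordinate representations in the charts
  around \<open>p\<close>, related by the differentials of the transition maps (and \<open>0\<close> at all other charts, so
  that equality of tangent vectors is equality of functions).\<close>

type_synonym ('m, 'e) tvec = "('m, 'e) chart \<Rightarrow> 'e"

definition transition_diff ::
  "('m, 'e::euclidean_space) chart \<Rightarrow> ('m, 'e) chart \<Rightarrow> 'm \<Rightarrow> 'e \<Rightarrow> 'e" where
  "transition_diff c c' p = frechet_derivative (snd c' \<circ> chart_inv c) (at (snd c p))"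

definition tangent_space ::
  "('m, 'e::euclidean_space) chart set \<Rightarrow> 'm \<Rightarrow> ('m, 'e) tvec set" where
  "tangent_space A p =
     {v. (\<forall>c. c \<notin> charts_at A p \<longrightarrow> v c = 0) \<and>
         (\<forall>c\<in>charts_at A p. \<forall>c'\<in>charts_at A p. v c' = transition_diff c c' p (v c))}"

text \<open>The tangent vector with coordinates \<open>w\<close> in the chart \<open>c\<close>; for \<open>w\<close> in \<open>Basis\<close> this is the
  coordinate vector \<open>\<partial>/\<partial>x\<^sub>j\<close>.\<close>

definition chart_vector ::
  "('m, 'e::euclidean_space) chart set \<Rightarrow> ('m, 'e) chart \<Rightarrow> 'm \<Rightarrow> 'e \<Rightarrow> ('m, 'e) tvec" where
  "chart_vector A c p w = (\<lambda>c'. if c' \<in> charts_at A p then transition_diff c c' p w else 0)"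

text \<open>Covectors are linear functionals on the tangent space, extended by \<open>0\<close>.\<close>

definition cotangent_space ::
  "('m, 'e::euclidean_space) chart set \<Rightarrow> 'm \<Rightarrow> (('m, 'e) tvec \<Rightarrow> real) set" where
  "cotangent_space A p =
     {\<xi>. (\<forall>v. v \<notin> tangent_space A p \<longrightarrow> \<xi> v = 0) \<and>
         (\<forall>v\<in>tangent_space A p. \<forall>w\<in>tangent_space A p. \<xi> (\<lambda>c. v c + w c) = \<xi> v + \<xi> w) \<and>
         (\<forall>v\<in>tangent_space A p. \<forall>a. \<xi> (\<lambda>c. a *\<^sub>R v c) = a * \<xi> v)}"

type_synonym ('m, 'e) cotangent = "'m \<times> (('m, 'e) tvec \<Rightarrow> real)"

definition cotangent_bundle ::
  "'m topology \<Rightarrow> ('m, 'e::euclidean_space) chart set \<Rightarrow> ('m, 'e) cotangent set" where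
  "cotangent_bundle X A = (SIGMA p:topspace X. cotangent_space A p)"

text \<open>Canonical coordinates \<open>(x, \<xi>)\<close> on the part of the cotangent bundle over \<open>fst c\<close>, with
  \<open>\<xi>\<^sub>j = \<xi>(\<partial>/\<partial>x\<^sub>j)\<close>, and their inverse.\<close>

definition canonical_coords ::
  "('m, 'e::euclidean_space) chart set \<Rightarrow> ('m, 'e) chart \<Rightarrow> ('m, 'e) cotangent \<Rightarrow> 'e \<times> 'e" where
  "canonical_coords A c \<rho> =
     (snd c (fst \<rho>), \<Sum>b\<in>Basis. snd \<rho> (chart_vector A c (fst \<rho>) b) *\<^sub>R b)"

definition canonical_coords_inv ::
  "('m, 'e::euclidean_space) chart set \<Rightarrow> ('m, 'e) chart \<Rightarrow> 'e \<times> 'e \<Rightarrow> ('m, 'e) cotangent" where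
  "canonical_coords_inv A c z =
     (let p = chart_inv c (fst z)
      in (p, \<lambda>v. if v \<in> tangent_space A p then snd z \<bullet> v c else 0))"

section \<open>Riemannian metrics\<close>

locale riemannian_manifold = smooth_manifold X A
  for X :: "'m topology" and A :: "('m, 'e::euclidean_space) chart set" +
  fixes g :: "'m \<Rightarrow> ('m, 'e) tvec \<Rightarrow> ('m, 'e) tvec \<Rightarrow> real"
  assumes metric_commute:
      "\<lbrakk>p \<in> topspace X; u \<in> tangent_space A p; v \<in> tangent_space A p\<rbrakk> \<Longrightarrow> g p u v = g p v u"
    and metric_add:
      "\<lbrakk>p \<in> topspace X; u \<in> tangent_space A p; v \<in> tangent_space A p; w \<in> tangent_space A p\<rbrakk>
        \<Longrightarrow> g p (\<lambda>c. u c + v c) w = g p u w + g p v w"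
    and metric_scale:
      "\<lbrakk>p \<in> topspace X; u \<in> tangent_space A p; v \<in> tangent_space A p\<rbrakk>
        \<Longrightarrow> g p (\<lambda>c. a *\<^sub>R u c) v = a * g p u v"
    and metric_pos:
      "\<lbrakk>p \<in> topspace X; u \<in> tangent_space A p; u \<noteq> (\<lambda>_. 0)\<rbrakk> \<Longrightarrow> g p u u > 0"
    and metric_smooth:
      "\<lbrakk>c \<in> A; b \<in> Basis; b' \<in> Basis\<rbrakk> \<Longrightarrow> smooth_on (chart_image c)
         (\<lambda>y. g (chart_inv c y) (chart_vector A c (chart_inv c y) b)
                                (chart_vector A c (chart_inv c y) b'))"

text \<open>The vector \<open>\<xi>\<^sup>\<sharp>\<close> dual to a covector, and the norm \<open>|\<xi>|\<^sub>g\<close> of a covector.\<close>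

definition sharp ::
  "('m, 'e::euclidean_space) chart set \<Rightarrow> ('m \<Rightarrow> ('m, 'e) tvec \<Rightarrow> ('m, 'e) tvec \<Rightarrow> real) \<Rightarrow>
   ('m, 'e) cotangent \<Rightarrow> ('m, 'e) tvec" where
  "sharp A g \<rho> = (THE v. v \<in> tangent_space A (fst \<rho>) \<and>
                          (\<forall>w\<in>tangent_space A (fst \<rho>). g (fst \<rho>) v w = snd \<rho> w))"

definition covector_norm ::
  "('m, 'e::euclidean_space) chart set \<Rightarrow> ('m \<Rightarrow> ('m, 'e) tvec \<Rightarrow> ('m, 'e) tvec \<Rightarrow> real) \<Rightarrow>
   ('m, 'e) cotangent \<Rightarrow> real" where
  "covector_norm A g \<rho> = sqrt (g (fst \<rho>) (sharp A g \<rho>) (sharp A g \<rho>))"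

section \<open>Hamiltonian flows\<close>

text \<open>The Hamiltonian vector field \<open>H\<^sub>k = \<Sum>\<^sub>j \<partial>k/\<partial>\<xi>\<^sub>j \<partial>/\<partial>x\<^sub>j - \<partial>k/\<partial>x\<^sub>j \<partial>/\<partial>\<xi>\<^sub>j\<close>, expressed in
  the canonical coordinates of the chart \<open>c\<close>.\<close>

definition hamiltonian_field ::
  "('m, 'e::euclidean_space) chart set \<Rightarrow> (('m, 'e) cotangent \<Rightarrow> real) \<Rightarrow> ('m, 'e) chart \<Rightarrow>
   'e \<times> 'e \<Rightarrow> 'e \<times> 'e" where
  "hamiltonian_field A k c z =
     (let D = frechet_derivative (k \<circ> canonical_coords_inv A c) (at z)
      in (\<Sum>b\<in>Basis. D (0, b) *\<^sub>R b, - (\<Sum>b\<in>Basis. D (b, 0) *\<^sub>R b)))"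

text \<open>Continuity of the base curve makes the canonical coordinates of \<open>\<gamma> s\<close> in \<open>c\<close> meaningful for
  all \<open>s\<close> near \<open>t\<close>.\<close>

definition hamiltonian_curve ::
  "'m topology \<Rightarrow> ('m, 'e::euclidean_space) chart set \<Rightarrow> (('m, 'e) cotangent \<Rightarrow> real) \<Rightarrow>
   real set \<Rightarrow> (real \<Rightarrow> ('m, 'e) cotangent) \<Rightarrow> bool" where
  "hamiltonian_curve X A k I \<gamma> \<longleftrightarrow>
     \<gamma> \<in> I \<rightarrow> cotangent_bundle X A \<and>
     continuous_map (top_of_set I) X (fst \<circ> \<gamma>) \<and>
     (\<forall>t\<in>I. \<forall>c\<in>charts_at A (fst (\<gamma> t)).
        ((\<lambda>s. canonical_coords A c (\<gamma> s)) has_vector_derivative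
           hamiltonian_field A k c (canonical_coords A c (\<gamma> t))) (at t))"

text \<open>\<open>\<phi>\<^sup>k\<^sub>t(\<rho>)\<close>: the value at time \<open>t\<close> of the integral curve of \<open>H\<^sub>k\<close> through \<open>\<rho>\<close>.  It is unspecified
  if that curve does not exist up to time \<open>t\<close>, which does not occur for smooth \<open>k\<close> with compact
  energy levels, such as \<open>symbol_q\<close> below on a compact manifold.\<close>

definition hamiltonian_flow ::
  "'m topology \<Rightarrow> ('m, 'e::euclidean_space) chart set \<Rightarrow> (('m, 'e) cotangent \<Rightarrow> real) \<Rightarrow>
   real \<Rightarrow> ('m, 'e) cotangent \<Rightarrow> ('m, 'e) cotangent" where
  "hamiltonian_flow X A k t \<rho> =
     (THE \<sigma>. \<exists>I \<gamma>. open I \<and> is_interval I \<and> 0 \<in> I \<and> t \<in> I \<and>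
                   hamiltonian_curve X A k I \<gamma> \<and> \<gamma> 0 = \<rho> \<and> \<gamma> t = \<sigma>)"

section \<open>The geometric control condition with potential\<close>

definition symbol_q ::
  "('m, 'e::euclidean_space) chart set \<Rightarrow> ('m \<Rightarrow> ('m, 'e) tvec \<Rightarrow> ('m, 'e) tvec \<Rightarrow> real) \<Rightarrow>
   ('m \<Rightarrow> real) \<Rightarrow> ('m, 'e) cotangent \<Rightarrow> real" where
  "symbol_q A g V \<rho> = sqrt ((covector_norm A g \<rho>)\<^sup>2 + V (fst \<rho>))"

definition GCC ::
  "'m topology \<Rightarrow> ('m, 'e::euclidean_space) chart set \<Rightarrow>
   ('m \<Rightarrow> ('m, 'e) tvec \<Rightarrow> ('m, 'e) tvec \<Rightarrow> real) \<Rightarrow> ('m \<Rightarrow> real) \<Rightarrow> 'm set \<Rightarrow> real \<Rightarrow> bool" where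
  "GCC X A g V \<omega> T \<longleftrightarrow>
     (\<forall>\<rho>\<in>cotangent_bundle X A.
        \<exists>t\<in>{0<..<T}. fst (hamiltonian_flow X A (symbol_q A g V) t \<rho>) \<in> \<omega>)"

end

theory Submission
  imports Defs
begin

text \<open>At a critical point \<open>x\<^sub>0\<close> of \<open>V\<close> the zero covector is a rest point of \<open>H\<^sub>q\<close>: in a chart,
  \<open>q = sqrt (N + V)\<close> where \<open>N\<close> is quadratic in \<open>\<xi>\<close>, so \<open>dq\<close> vanishes at \<open>(x\<^sub>0, 0)\<close>.  Hence the flow
  never moves \<open>(x\<^sub>0, 0)\<close>, whose projection stays outside \<open>\<omega>\<close>.  For uniqueness of the
  integral curve it suffices that \<open>H\<^sub>q(z) = O(z - (x\<^sub>0, 0))\<close>: by the mean value theorem a curve that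
  is at the rest point at some time is there at all nearby times, and the set of such times is both
  open and closed in the interval of definition.\<close>

section \<open>The kinetic energy of a metric in coordinates\<close>

lemma differentiable_imp_lipschitz_at:
  fixes f :: "'a::real_normed_vector \<Rightarrow> 'b::real_normed_vector"
  assumes "f differentiable at x"
  obtains L where "L \<ge> 0" "\<forall>\<^sub>F y in nhds x. norm (f y - f x) \<le> L * norm (y - x)"
proof -
  obtain f' where f': "bounded_linear f'"
    and "\<forall>e>0. \<exists>d>0. \<forall>y. norm (y - x) < d \<longrightarrow> norm (f y - f x - f' (y - x)) \<le> e * norm (y - x)"
    using assms unfolding differentiable_def has_derivative_at_alt by blast
  then obtain d where d: "d > 0"
    "\<And>y. norm (y - x) < d \<Longrightarrow> norm (f y - f x - f' (y - x)) \<le> 1 * norm (y - x)"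
    using zero_less_one by blast
  \<comment> \<open>The linear part contributes \<open>onorm f'\<close>; the 1 is the error of the
    linear approximation for epsilon 1.\<close>
  have "norm (f y - f x) \<le> (onorm f' + 1) * norm (y - x)" if "norm (y - x) < d" for y
    using d(2)[OF that] onorm[OF f', of "y - x"] norm_triangle_sub[of "f y - f x" "f' (y - x)"]
    by (simp add: algebra_simps)
  then have "\<forall>\<^sub>F y in nhds x. norm (f y - f x) \<le> (onorm f' + 1) * norm (y - x)"
    using d(1) by (auto simp: eventually_nhds_metric dist_norm)
  moreover have "onorm f' + 1 \<ge> 0"
    using onorm_pos_le[OF f'] by simp
  ultimately show thesis by (rule that[rotated])
qed

lemma has_derivative_zero_quadratic:
  fixes f :: "'a::real_normed_vector \<Rightarrow> 'b::real_normed_vector"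
  assumes "\<forall>\<^sub>F y in nhds x. norm (f y) \<le> K * (norm (y - x))\<^sup>2"
  shows "(f has_derivative (\<lambda>_. 0)) (at x)"
  unfolding has_derivative_at_alt
proof (intro conjI allI impI)
  fix e :: real
  assume e: "e > 0"
  obtain d where d: "d > 0" "\<And>y. norm (y - x) < d \<Longrightarrow> norm (f y) \<le> K * (norm (y - x))\<^sup>2"
    using assms by (auto simp: eventually_nhds_metric dist_norm)
  have fx: "f x = 0"
    using d(2)[of x] d(1) by simp
  have "norm (f y - f x - 0) \<le> e * norm (y - x)"
    \<comment> \<open>\<open>\<bar>K\<bar> + 1\<close> is positive for every sign of
      \<open>K\<close>, and within this radius \<open>K * norm (y - x)\<close> is at most
      \<open>e\<close>.\<close>
    if y: "norm (y - x) < min d (e / (\<bar>K\<bar> + 1))" for y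
  proof -
    have "(\<bar>K\<bar> + 1) * norm (y - x) \<le> e"
      using y by (simp add: field_simps)
    moreover have "K * norm (y - x) \<le> (\<bar>K\<bar> + 1) * norm (y - x)"
      by (intro mult_right_mono) auto
    ultimately have "K * norm (y - x) * norm (y - x) \<le> e * norm (y - x)"
      by (intro mult_right_mono) auto
    then show ?thesis
      using d(2)[of y] y fx by (simp add: power2_eq_square mult.assoc)
  qed
  then show "\<exists>d>0. \<forall>y. norm (y - x) < d \<longrightarrow> norm (f y - f x - 0) \<le> e * norm (y - x)"
    using d(1) e by (intro exI[of _ "min d (e / (\<bar>K\<bar> + 1))"]) auto
qed simp

lemma smooth_on_differentiable: "smooth_on S f \<Longrightarrow> x \<in> S \<Longrightarrow> f differentiable at x"
  unfolding smooth_on_def by (metis Ck_on.simps(2))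

lemma smooth_on_frechet_derivative:
  assumes "smooth_on S f"
  shows "smooth_on S (\<lambda>x. frechet_derivative f (at x) v)"
  using assms unfolding smooth_on_def by (metis Ck_on.simps(2))

lemma smooth_on_continuous_on: "smooth_on S f \<Longrightarrow> continuous_on S f"
  unfolding smooth_on_def by (metis Ck_on.simps(1))

lemma isCont_imp_tendsto_nhds: "isCont f x \<Longrightarrow> (f \<longlongrightarrow> f x) (nhds x)"
  using tendsto_at_iff_tendsto_nhds[of f x] by (simp add: isCont_def)

section \<open>Smooth families of inner products on an open set of coordinates\<close>

locale smooth_metric =
  fixes U :: "'e::euclidean_space set" and B :: "'e \<Rightarrow> 'e \<Rightarrow> 'e \<Rightarrow> real"
  assumes open_dom: "open U"
    and bilinear: "y \<in> U \<Longrightarrow> bilinear (B y)"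
    and commute: "y \<in> U \<Longrightarrow> B y a b = B y b a"
    and pos: "y \<in> U \<Longrightarrow> a \<noteq> 0 \<Longrightarrow> B y a a > 0"
    and smooth: "i \<in> Basis \<Longrightarrow> j \<in> Basis \<Longrightarrow> smooth_on U (\<lambda>y. B y i j)"
begin

text \<open>Smoothness in \<open>y\<close> is given for the finitely many matrix entries only;
  through this expansion continuity, Lipschitz bounds and derivatives pass from the entries to the
  form.\<close>

lemma expand:
  assumes "y \<in> U"
  shows "B y a b = (\<Sum>i\<in>Basis. \<Sum>j\<in>Basis. (a \<bullet> i) * (b \<bullet> j) * B y i j)"
proof -
  have "B y a b = B y (\<Sum>i\<in>Basis. (a \<bullet> i) *\<^sub>R i) (\<Sum>j\<in>Basis. (b \<bullet> j) *\<^sub>R j)"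
    by (simp add: euclidean_representation)
  also have "\<dots> = (\<Sum>(i, j)\<in>Basis \<times> Basis. B y ((a \<bullet> i) *\<^sub>R i) ((b \<bullet> j) *\<^sub>R j))"
    by (rule bilinear_sum[OF bilinear[OF assms]])
  also have "\<dots> = (\<Sum>i\<in>Basis. \<Sum>j\<in>Basis. (a \<bullet> i) * (b \<bullet> j) * B y i j)"
    by (simp add: sum.cartesian_product bilinear_lmul[OF bilinear[OF assms]]
        bilinear_rmul[OF bilinear[OF assms]] algebra_simps)
  finally show ?thesis .
qed

text \<open>On the compact product of a closed ball around \<open>y\<^sub>0\<close> and the unit
  sphere, the continuous function \<open>B y a a\<close> attains its minimum, which is positive.
  Homogeneity of degree 2 in \<open>a\<close> carries the bound to all vectors.\<close>

lemma coercive: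
  assumes "y\<^sub>0 \<in> U"
  obtains m where "m > 0" "\<forall>\<^sub>F y in nhds y\<^sub>0. y \<in> U \<and> (\<forall>a. m * (norm a)\<^sup>2 \<le> B y a a)"
proof -
  obtain r where r: "r > 0" "cball y\<^sub>0 r \<subseteq> U"
    using open_dom assms open_contains_cball by blast
  define K where "K = cball y\<^sub>0 r \<times> sphere (0::'e) 1"
  have KU: "fst z \<in> U" if "z \<in> K" for z
    using that r unfolding K_def by auto
  have "continuous_on K (\<lambda>z. \<Sum>i\<in>Basis. \<Sum>j\<in>Basis. (snd z \<bullet> i) * (snd z \<bullet> j) * B (fst z) i j)"
    using KU by (intro continuous_intros continuous_on_compose2[OF smooth_on_continuous_on[OF smooth]]) auto
  then have cont: "continuous_on K (\<lambda>z. B (fst z) (snd z) (snd z))"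
    by (rule continuous_on_eq) (simp add: expand[OF KU])
  have "compact K"
    unfolding K_def by (intro compact_Times) auto
  moreover have "K \<noteq> {}"
  proof -
    obtain b :: 'e where "b \<in> Basis"
      using nonempty_Basis by blast
    then have "(y\<^sub>0, b) \<in> K"
      using r(1) unfolding K_def by simp
    then show ?thesis by blast
  qed
  ultimately obtain z where z: "z \<in> K" "\<And>x. x \<in> K \<Longrightarrow> B (fst z) (snd z) (snd z) \<le> B (fst x) (snd x) (snd x)"
    using continuous_attains_inf[OF _ _ cont] by metis
  define m where "m = B (fst z) (snd z) (snd z)"
  have m: "m > 0"
    unfolding m_def using z(1) KU[OF z(1)] unfolding K_def by (intro pos) auto
  have "m * (norm a)\<^sup>2 \<le> B y a a" if y: "y \<in> cball y\<^sub>0 r" for y a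
  proof (cases "a = 0")
    case True
    then show ?thesis
      using bilinear_lzero[OF bilinear[of y]] y r by auto
  next
    case False
    define u where "u = inverse (norm a) *\<^sub>R a"
    have "m \<le> B y u u"
      using z(2)[of "(y, u)"] y False unfolding m_def K_def u_def by auto
    moreover have "y \<in> U"
      using y r by auto
    then have "B y a a = (norm a)\<^sup>2 * B y u u"
      using False unfolding u_def
      by (simp add: bilinear_lmul[OF bilinear] bilinear_rmul[OF bilinear] power2_eq_square field_simps)
    ultimately show ?thesis
      by (simp add: mult.commute mult_right_mono)
  qed
  moreover have "\<forall>\<^sub>F y in nhds y\<^sub>0. y \<in> cball y\<^sub>0 r"
    using r(1) by (auto simp: eventually_nhds_metric dist_commute intro!: exI[of _ r])
  ultimately have "\<forall>\<^sub>F y in nhds y\<^sub>0. y \<in> U \<and> (\<forall>a. m * (norm a)\<^sup>2 \<le> B y a a)"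
    using r(2) by (auto elim!: eventually_mono)
  then show thesis using m that by blast
qed

text \<open>Each entry is differentiable at \<open>y\<close>, hence Lipschitz with respect to this
  centre. Coordinates are bounded by norms, so the constants of the entries simply add up.\<close>

lemma lipschitz_at:
  assumes "y \<in> U"
  obtains L where "L \<ge> 0"
    "\<forall>\<^sub>F x in nhds y. x \<in> U \<and> (\<forall>v w. \<bar>B x v w - B y v w\<bar> \<le> L * norm (x - y) * norm v * norm w)"
proof -
  define L where
    "L i j = (SOME L. L \<ge> 0 \<and> (\<forall>\<^sub>F x in nhds y. norm (B x i j - B y i j) \<le> L * norm (x - y)))" for i j
  have L: "L i j \<ge> 0 \<and> (\<forall>\<^sub>F x in nhds y. norm (B x i j - B y i j) \<le> L i j * norm (x - y))"
    if "i \<in> Basis" "j \<in> Basis" for i j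
    unfolding L_def
    by (rule someI_ex)
      (use differentiable_imp_lipschitz_at[OF smooth_on_differentiable[OF smooth[OF that] assms]] in blast)
  define S where "S = (\<Sum>i\<in>Basis. \<Sum>j\<in>Basis. L i j)"
  have "\<forall>\<^sub>F x in nhds y. x \<in> U \<and> (\<forall>i\<in>Basis. \<forall>j\<in>Basis. norm (B x i j - B y i j) \<le> L i j * norm (x - y))"
    using L eventually_nhds_in_open[OF open_dom assms]
    by (intro eventually_conj eventually_ball_finite ballI) auto
  then have "\<forall>\<^sub>F x in nhds y. x \<in> U \<and> (\<forall>v w. \<bar>B x v w - B y v w\<bar> \<le> S * norm (x - y) * norm v * norm w)"
  proof (rule eventually_mono, safe)
    fix x v w
    assume x: "x \<in> U" "\<forall>i\<in>Basis. \<forall>j\<in>Basis. norm (B x i j - B y i j) \<le> L i j * norm (x - y)"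
    have "\<bar>B x v w - B y v w\<bar> = \<bar>\<Sum>i\<in>Basis. \<Sum>j\<in>Basis. (v \<bullet> i) * (w \<bullet> j) * (B x i j - B y i j)\<bar>"
      by (simp add: expand[OF x(1), of v w] expand[OF assms, of v w] sum_subtractf algebra_simps)
    also have "\<dots> \<le> (\<Sum>i\<in>Basis. \<Sum>j\<in>Basis. \<bar>(v \<bullet> i) * (w \<bullet> j) * (B x i j - B y i j)\<bar>)"
      by (rule order_trans[OF sum_abs]) (intro sum_mono sum_abs)
    also have "\<dots> \<le> (\<Sum>i\<in>Basis. \<Sum>j\<in>Basis. (norm v * norm w) * (L i j * norm (x - y)))"
      unfolding abs_mult using x(2)
      by (intro sum_mono mult_mono) (auto simp: Basis_le_norm)
    also have "\<dots> = S * norm (x - y) * norm v * norm w"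
      unfolding S_def by (simp add: sum_distrib_left sum_distrib_right mult_ac)
    finally show "\<bar>B x v w - B y v w\<bar> \<le> S * norm (x - y) * norm v * norm w" .
  qed
  moreover have "S \<ge> 0"
    unfolding S_def using L by (intro sum_nonneg) auto
  ultimately show thesis by (rule that[rotated])
qed

text \<open>The derivative in direction \<open>h\<close> of \<open>B y v v\<close> as a function of
  \<open>y\<close>, with \<open>v\<close> frozen. Written through the entries, it is visibly
  quadratic in \<open>v\<close>.\<close>

definition form_deriv :: "'e \<Rightarrow> 'e \<Rightarrow> 'e \<Rightarrow> real" where
  "form_deriv y v h =
     (\<Sum>i\<in>Basis. \<Sum>j\<in>Basis. (v \<bullet> i) * (v \<bullet> j) * frechet_derivative (\<lambda>y. B y i j) (at y) h)"

lemma has_derivative_form: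
  assumes "y \<in> U"
  shows "((\<lambda>y. B y v v) has_derivative form_deriv y v) (at y)"
proof -
  have "((\<lambda>y. \<Sum>i\<in>Basis. \<Sum>j\<in>Basis. (v \<bullet> i) * (v \<bullet> j) * B y i j) has_derivative form_deriv y v) (at y)"
    unfolding form_deriv_def using smooth_on_differentiable[OF smooth assms]
    by (auto intro!: derivative_eq_intros simp: frechet_derivative_works)
  then show ?thesis
    by (rule has_derivative_transform_within_open[OF _ open_dom assms]) (simp add: expand)
qed

text \<open>The first derivatives of the entries are continuous, so near \<open>y\<^sub>0\<close>
  their absolute values stay below those at \<open>y\<^sub>0\<close> plus 1; the two factors from
  \<open>v\<close> give the square of its norm.\<close>

lemma form_deriv_bounded:
  assumes "y\<^sub>0 \<in> U" "b \<in> Basis"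
  obtains C where "C \<ge> 0" "\<forall>\<^sub>F y in nhds y\<^sub>0. \<forall>v. \<bar>form_deriv y v b\<bar> \<le> C * (norm v)\<^sup>2"
proof -
  define L where "L i j = \<bar>frechet_derivative (\<lambda>y. B y i j) (at y\<^sub>0) b\<bar> + 1" for i j
  define S where "S = (\<Sum>i\<in>(Basis::'e set). \<Sum>j\<in>Basis. L i j)"
  have "\<forall>\<^sub>F y in nhds y\<^sub>0. \<bar>frechet_derivative (\<lambda>y. B y i j) (at y) b\<bar> < L i j"
    if "i \<in> Basis" "j \<in> Basis" for i j
  proof -
    have "isCont (\<lambda>y. frechet_derivative (\<lambda>y. B y i j) (at y) b) y\<^sub>0"
      using smooth_on_continuous_on[OF smooth_on_frechet_derivative[OF smooth[OF that]]]
      by (simp add: continuous_on_eq_continuous_at[OF open_dom] assms)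
    then have "((\<lambda>y. \<bar>frechet_derivative (\<lambda>y. B y i j) (at y) b\<bar>) \<longlongrightarrow>
        \<bar>frechet_derivative (\<lambda>y. B y i j) (at y\<^sub>0) b\<bar>) (nhds y\<^sub>0)"
      by (intro tendsto_rabs isCont_imp_tendsto_nhds)
    then show ?thesis
      by (rule order_tendstoD(2)) (simp add: L_def)
  qed
  then have "\<forall>\<^sub>F y in nhds y\<^sub>0. \<forall>i\<in>Basis. \<forall>j\<in>Basis. \<bar>frechet_derivative (\<lambda>y. B y i j) (at y) b\<bar> < L i j"
    by (intro eventually_ball_finite ballI) auto
  then have "\<forall>\<^sub>F y in nhds y\<^sub>0. \<forall>v. \<bar>form_deriv y v b\<bar> \<le> S * (norm v)\<^sup>2"
  proof (rule eventually_mono, safe)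
    fix y v
    assume y: "\<forall>i\<in>Basis. \<forall>j\<in>Basis. \<bar>frechet_derivative (\<lambda>y. B y i j) (at y) b\<bar> < L i j"
    have "\<bar>form_deriv y v b\<bar> \<le>
        (\<Sum>i\<in>Basis. \<Sum>j\<in>Basis. \<bar>(v \<bullet> i) * (v \<bullet> j) * frechet_derivative (\<lambda>y. B y i j) (at y) b\<bar>)"
      unfolding form_deriv_def by (rule order_trans[OF sum_abs]) (intro sum_mono sum_abs)
    also have "\<dots> \<le> (\<Sum>i\<in>Basis. \<Sum>j\<in>Basis. (norm v * norm v) * L i j)"
      unfolding abs_mult using y
      by (intro sum_mono mult_mono) (auto simp: Basis_le_norm less_imp_le)
    also have "\<dots> = S * (norm v)\<^sup>2"
      unfolding S_def by (simp add: sum_distrib_left sum_distrib_right mult_ac power2_eq_square)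
    finally show "\<bar>form_deriv y v b\<bar> \<le> S * (norm v)\<^sup>2" .
  qed
  moreover have "S \<ge> 0"
    unfolding S_def L_def by (intro sum_nonneg) auto
  ultimately show thesis by (rule that[rotated])
qed

text \<open>Differentiating the inverse matrix is avoided: \<open>N z\<close> is the maximum over \<open>w\<close> of
  \<open>2 * (snd z \<bullet> w) - B (fst z) w w\<close>, attained at the dual vector \<open>v\<close>, so freezing \<open>w\<close> at the dual vector
  of a nearby point costs exactly \<open>B (fst z) d d\<close> with \<open>d\<close> the difference of the two dual vectors,
  which is of second order.\<close>

lemma has_derivative_dual_norm_squared:
  assumes N: "\<And>z. fst z \<in> U \<Longrightarrow> \<exists>v. (\<forall>w. B (fst z) v w = snd z \<bullet> w) \<and> N z = B (fst z) v v"
    and y: "y \<in> U" and v: "\<And>w. B y v w = \<eta> \<bullet> w"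
  shows "(N has_derivative (\<lambda>h. 2 * (v \<bullet> snd h) - form_deriv y v (fst h))) (at (y, \<eta>))"
proof -
  obtain m where m: "m > 0" "\<forall>\<^sub>F x in nhds y. x \<in> U \<and> (\<forall>a. m * (norm a)\<^sup>2 \<le> B x a a)"
    using coercive[OF y] .
  obtain L where L: "L \<ge> 0"
    "\<forall>\<^sub>F x in nhds y. x \<in> U \<and> (\<forall>v w. \<bar>B x v w - B y v w\<bar> \<le> L * norm (x - y) * norm v * norm w)"
    using lipschitz_at[OF y] .
  \<comment> \<open>What is left of \<open>N\<close> after subtracting the function with frozen
    \<open>v\<close>. Once \<open>R\<close> is of second order, \<open>N\<close> inherits the
    derivative of the subtracted function.\<close>
  define R where "R z = N z - (2 * (v \<bullet> snd z) - B (fst z) v v)" for z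
  \<comment> \<open>Comes from inserting \<open>m * norm d \<le> (1 + L * norm v) * n\<close> into
    \<open>B y' d d \<le> (1 + L * norm v) * n * norm d\<close>.\<close>
  define K where "K = (1 + L * norm v)\<^sup>2 / m"
  have "filterlim fst (nhds y) (nhds (y, \<eta>))"
    by (rule tendsto_eq_intros filterlim_ident | simp)+
  then have "\<forall>\<^sub>F z in nhds (y, \<eta>). (fst z \<in> U \<and> (\<forall>a. m * (norm a)\<^sup>2 \<le> B (fst z) a a)) \<and>
      (\<forall>v w. \<bar>B (fst z) v w - B y v w\<bar> \<le> L * norm (fst z - y) * norm v * norm w)"
    using eventually_conj[OF m(2) L(2)] by (auto simp: filterlim_iff elim: eventually_mono)
  then have "\<forall>\<^sub>F z in nhds (y, \<eta>). norm (R z) \<le> K * (norm (z - (y, \<eta>)))\<^sup>2"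
  proof (rule eventually_mono, safe)
    fix y' \<eta>' :: 'e
    assume U: "fst (y', \<eta>') \<in> U"
      and co: "\<forall>a. m * (norm a)\<^sup>2 \<le> B (fst (y', \<eta>')) a a"
      and lip: "\<forall>v w. \<bar>B (fst (y', \<eta>')) v w - B y v w\<bar> \<le> L * norm (fst (y', \<eta>') - y) * norm v * norm w"
    obtain v' where v': "\<And>w. B y' v' w = \<eta>' \<bullet> w" "N (y', \<eta>') = B y' v' v'"
      using N[OF U] by (metis fst_conv snd_conv)
    define d where "d = v' - v"
    define n where "n = norm ((y', \<eta>') - (y, \<eta>))"
    note bil = bilinear_lsub[OF bilinear[of y']] bilinear_rsub[OF bilinear[of y']]
    have n: "norm (y' - y) \<le> n" "norm (\<eta>' - \<eta>) \<le> n"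
      unfolding n_def using norm_fst_le[of "y' - y" "\<eta>' - \<eta>"] norm_snd_le[of "\<eta>' - \<eta>" "y' - y"] by auto
    \<comment> \<open>Completing the square, with
      \<open>\<eta>' \<bullet> v = B y' v' v\<close>.\<close>
    have R: "R (y', \<eta>') = B y' d d"
      using U v' commute[of y' v v'] unfolding R_def d_def
      by (simp add: bil inner_commute)
    \<comment> \<open>Uses \<open>B y' v' d = \<eta>' \<bullet> d\<close> and
      \<open>B y v d = \<eta> \<bullet> d\<close>: the dual vector moves because the covector
      changes and because the form changes, and both effects are of first order in
      \<open>n\<close>.\<close>
    have "B y' d d = (\<eta>' - \<eta>) \<bullet> d - (B y' v d - B y v d)"
      using U unfolding v v'(1)[symmetric] inner_diff_left d_def by (simp add: bil)
    also have "\<dots> \<le> n * norm d + L * n * norm v * norm d"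
    proof -
      have "(\<eta>' - \<eta>) \<bullet> d \<le> n * norm d"
        by (meson norm_cauchy_schwarz n(2) mult_right_mono norm_ge_zero order_trans)
      moreover have "\<bar>B y' v d - B y v d\<bar> \<le> L * norm (y' - y) * norm v * norm d"
        using lip by simp
      moreover have "L * norm (y' - y) * norm v * norm d \<le> L * n * norm v * norm d"
        using n L(1) by (intro mult_right_mono mult_left_mono) auto
      ultimately show ?thesis by linarith
    qed
    finally have up: "B y' d d \<le> (1 + L * norm v) * n * norm d"
      by (simp add: algebra_simps)
    have low: "m * (norm d)\<^sup>2 \<le> B y' d d"
      using co by simp
    have d: "m * norm d \<le> (1 + L * norm v) * n"
    proof (cases "d = 0")
      case True
      then show ?thesis using L(1) unfolding n_def by simp
    next
      case False
      have "m * norm d * norm d \<le> (1 + L * norm v) * n * norm d"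
        using up low by (simp add: power2_eq_square mult.assoc)
      then show ?thesis using False by simp
    qed
    have "m * B y' d d \<le> (1 + L * norm v) * n * (m * norm d)"
      using up m(1) by (simp add: mult_left_mono mult_ac)
    also have "\<dots> \<le> (1 + L * norm v) * n * ((1 + L * norm v) * n)"
      using d L(1) unfolding n_def by (intro mult_left_mono) auto
    finally have "B y' d d \<le> K * n\<^sup>2"
      using m(1) unfolding K_def by (simp add: field_simps power2_eq_square)
    moreover have "B y' d d \<ge> 0"
      using low m(1) by (meson mult_nonneg_nonneg less_imp_le order_trans zero_le_power2)
    ultimately show "norm (R (y', \<eta>')) \<le> K * (norm ((y', \<eta>') - (y, \<eta>)))\<^sup>2"
      unfolding R n_def by simp
  qed
  then have "(R has_derivative (\<lambda>_. 0)) (at (y, \<eta>))"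
    by (rule has_derivative_zero_quadratic)
  moreover have "((\<lambda>z. B (fst z) v v) has_derivative (\<lambda>h. form_deriv y v (fst h))) (at (y, \<eta>))"
    by (rule has_derivative_compose[where g = "\<lambda>y. B y v v" and f = fst])
      (auto intro!: derivative_eq_intros has_derivative_form y)
  ultimately have "((\<lambda>z. R z + (2 * (v \<bullet> snd z) - B (fst z) v v)) has_derivative
      (\<lambda>h. 0 + (2 * (v \<bullet> snd h) - form_deriv y v (fst h)))) (at (y, \<eta>))"
    by (intro has_derivative_add has_derivative_diff has_derivative_mult_right has_derivative_inner_right
        has_derivative_snd has_derivative_ident)
  then show ?thesis
    unfolding R_def by simp
qed

text \<open>\<open>G\<close> is the linear map that lowers the index. Positivity makes it injective,
  and an injective linear endomorphism in finite dimension is surjective.\<close>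

lemma ex_dual:
  assumes "y \<in> U"
  shows "\<exists>v. \<forall>w. B y v w = \<eta> \<bullet> w"
proof -
  note lin = bilinear[OF assms, unfolded bilinear_def]
  define G where "G a = (\<Sum>b\<in>Basis. B y a b *\<^sub>R b)" for a
  have G: "G a \<bullet> w = B y a w" for a w
  proof -
    have "B y a (\<Sum>b\<in>Basis. (w \<bullet> b) *\<^sub>R b) = (\<Sum>b\<in>Basis. (w \<bullet> b) * B y a b)"
      using lin by (simp add: linear_sum linear_cmul)
    then show ?thesis
      by (simp add: G_def euclidean_representation inner_sum_right inner_commute[of _ w] mult.commute)
  qed
  have "linear G"
    by (rule linearI; rule euclidean_eqI)
      (simp_all add: G inner_add_left bilinear_ladd[OF bilinear[OF assms]] bilinear_lmul[OF bilinear[OF assms]])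
  moreover have "inj G"
  proof -
    have "a = 0" if "G a = 0" for a
      using G[of a a] pos[OF assms, of a] that by force
    then show ?thesis
      using linear_injective_0[OF \<open>linear G\<close>] by blast
  qed
  ultimately have "surj G"
    by (rule eucl.linear_inj_imp_surj)
  then obtain v where "G v = \<eta>"
    by (metis surjD)
  then show ?thesis
    using G by metis
qed

text \<open>\<open>F\<close> is \<open>sqrt (N + W)\<close> with \<open>N\<close> the squared dual
  norm, so its derivative is that of \<open>N + W\<close> divided by \<open>2 * F\<close>. The
  denominator stays away from 0 because \<open>W\<close> is positive; in the numerator the dual
  vector is linear in the covector, the \<open>y\<close>-derivative of \<open>N\<close> is quadratic
  in it, and the derivative of \<open>W\<close> is Lipschitz at \<open>y\<^sub>0\<close> and
  vanishes there.\<close>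

lemma energy_gradient_bound:
  assumes F: "\<And>z. fst z \<in> U \<Longrightarrow>
        \<exists>v. (\<forall>w. B (fst z) v w = snd z \<bullet> w) \<and> F z = sqrt (B (fst z) v v + W (fst z))"
    and W: "smooth_on U W" "\<And>y. y \<in> U \<Longrightarrow> W y > 0"
    and y\<^sub>0: "y\<^sub>0 \<in> U" and crit: "(W has_derivative (\<lambda>_. 0)) (at y\<^sub>0)" and b: "b \<in> Basis"
  shows "\<exists>C\<ge>0. \<forall>\<^sub>F z in nhds (y\<^sub>0, 0).
           \<bar>frechet_derivative F (at z) (0, b)\<bar> \<le> C * norm (z - (y\<^sub>0, 0)) \<and>
           \<bar>frechet_derivative F (at z) (b, 0)\<bar> \<le> C * norm (z - (y\<^sub>0, 0))"
proof -
  \<comment> \<open>Recovering \<open>N\<close> by squaring \<open>F\<close> turns the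
    vector-dependent description of \<open>F\<close> into a single function that can be
    differentiated.\<close>
  define N where "N z = (F z)\<^sup>2 - W (fst z)" for z
  have nonneg: "B y v v \<ge> 0" if "y \<in> U" for y v
    using pos[OF that, of v] bilinear_lzero[OF bilinear[OF that]] by (cases "v = 0") auto
  have N: "\<exists>v. (\<forall>w. B (fst z) v w = snd z \<bullet> w) \<and> N z = B (fst z) v v" if z: "fst z \<in> U" for z
  proof -
    obtain v where v: "\<forall>w. B (fst z) v w = snd z \<bullet> w" "F z = sqrt (B (fst z) v v + W (fst z))"
      using F[OF z] by blast
    have "N z = B (fst z) v v"
      using nonneg[OF z, of v] W(2)[OF z] by (simp add: N_def v(2))
    then show ?thesis using v(1) by blast
  qed
  obtain m where m: "m > 0" "\<forall>\<^sub>F y in nhds y\<^sub>0. y \<in> U \<and> (\<forall>a. m * (norm a)\<^sup>2 \<le> B y a a)"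
    using coercive[OF y\<^sub>0] .
  obtain K where K: "K \<ge> 0" "\<forall>\<^sub>F y in nhds y\<^sub>0. \<forall>v. \<bar>form_deriv y v b\<bar> \<le> K * (norm v)\<^sup>2"
    using form_deriv_bounded[OF y\<^sub>0 b] .
  obtain L where L: "L \<ge> 0" "\<forall>\<^sub>F y in nhds y\<^sub>0. norm (frechet_derivative W (at y) b -
      frechet_derivative W (at y\<^sub>0) b) \<le> L * norm (y - y\<^sub>0)"
    using differentiable_imp_lipschitz_at[OF
        smooth_on_differentiable[OF smooth_on_frechet_derivative[OF W(1)] y\<^sub>0]] .
  have W0: "frechet_derivative W (at y\<^sub>0) b = 0"
    using frechet_derivative_at[OF crit] by metis
  \<comment> \<open>A lower bound for \<open>F\<close> near \<open>(y\<^sub>0, 0)\<close>: by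
    continuity \<open>W\<close> stays above half its value at \<open>y\<^sub>0\<close>, and the form
    only adds to it.\<close>
  define s where "s = sqrt (W y\<^sub>0 / 2)"
  have s: "s > 0"
    using W(2)[OF y\<^sub>0] by (simp add: s_def)
  have "isCont W y\<^sub>0"
    using crit has_derivative_continuous by blast
  then have "\<forall>\<^sub>F y in nhds y\<^sub>0. W y\<^sub>0 / 2 < W y"
    using W(2)[OF y\<^sub>0] by (intro order_tendstoD(1)[OF isCont_imp_tendsto_nhds]) auto
  then have "\<forall>\<^sub>F y in nhds y\<^sub>0. s \<le> sqrt (W y)"
    by (rule eventually_mono) (simp add: s_def)
  then have ev: "\<forall>\<^sub>F y in nhds y\<^sub>0. y \<in> U \<and> (\<forall>a. m * (norm a)\<^sup>2 \<le> B y a a) \<and>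
      (\<forall>v. \<bar>form_deriv y v b\<bar> \<le> K * (norm v)\<^sup>2) \<and>
      \<bar>frechet_derivative W (at y) b\<bar> \<le> L * norm (y - y\<^sub>0) \<and> s \<le> sqrt (W y)"
    using m(2) K(2) L(2) by eventually_elim (simp add: W0)
  have "filterlim fst (nhds y\<^sub>0) (nhds (y\<^sub>0, 0::'e))"
    by (rule tendsto_eq_intros filterlim_ident | simp)+
  with ev have ev1: "\<forall>\<^sub>F z in nhds (y\<^sub>0, 0::'e). fst z \<in> U \<and> (\<forall>a. m * (norm a)\<^sup>2 \<le> B (fst z) a a) \<and>
      (\<forall>v. \<bar>form_deriv (fst z) v b\<bar> \<le> K * (norm v)\<^sup>2) \<and>
      \<bar>frechet_derivative W (at (fst z)) b\<bar> \<le> L * norm (fst z - y\<^sub>0) \<and> s \<le> sqrt (W (fst z))"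
    unfolding filterlim_iff by blast
  \<comment> \<open>Radius 1 makes \<open>n * n \<le> n\<close>, so the term quadratic in the dual
    vector is also bounded linearly.\<close>
  have ev2: "\<forall>\<^sub>F z in nhds (y\<^sub>0, 0::'e). norm (z - (y\<^sub>0, 0)) < 1"
    unfolding eventually_nhds_metric by (auto simp: dist_norm intro!: exI[of _ 1])
  \<comment> \<open>The summands control the dual vector, \<open>form_deriv\<close> and the
    derivative of \<open>W\<close>, in this order; \<open>s\<close> bounds the denominator
    \<open>F z\<close> from below.\<close>
  define C where "C = (1 / m + K / m\<^sup>2 + L) / s"
  have "\<forall>\<^sub>F z in nhds (y\<^sub>0, 0). \<bar>frechet_derivative F (at z) (0, b)\<bar> \<le> C * norm (z - (y\<^sub>0, 0)) \<and>
      \<bar>frechet_derivative F (at z) (b, 0)\<bar> \<le> C * norm (z - (y\<^sub>0, 0))"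
    using ev1 ev2
  proof eventually_elim
    case (elim z)
    obtain y \<eta> where z: "z = (y, \<eta>)" by (cases z)
    define n where "n = norm (z - (y\<^sub>0, 0))"
    have n: "norm (y - y\<^sub>0) \<le> n" "norm \<eta> \<le> n" "n < 1" "n \<ge> 0"
      using elim(2) norm_fst_le[of "y - y\<^sub>0" \<eta>] norm_snd_le[of \<eta> "y - y\<^sub>0"]
      unfolding n_def z by auto
    have y: "y \<in> U" using elim z by simp
    obtain v where v: "\<And>w. B y v w = \<eta> \<bullet> w" and Fz: "F z = sqrt (B y v v + W y)"
      using F[of z] y z by (metis fst_conv snd_conv)
    have "s \<le> sqrt (W y)"
      using elim(1) by (simp add: z)
    also have "\<dots> \<le> F z"
      using nonneg[OF y, of v] by (simp add: Fz)
    finally have Fs: "s \<le> F z" .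
    \<comment> \<open>Coercivity meets Cauchy-Schwarz in
      \<open>B y v v = \<eta> \<bullet> v\<close>.\<close>
    have "m * (norm v)\<^sup>2 \<le> norm \<eta> * norm v"
      using elim(1) v[of v] norm_cauchy_schwarz[of \<eta> v] unfolding z
      by (metis fst_conv order_trans)
    then have mv: "m * norm v \<le> norm \<eta>"
      by (cases "v = 0") (auto simp: power2_eq_square)
    then have nv: "norm v \<le> n / m"
      using m(1) n(2) by (simp add: field_simps)
    then have "(norm v)\<^sup>2 \<le> (n / m)\<^sup>2"
      by (simp add: power_mono)
    also have "\<dots> \<le> n / m\<^sup>2"
      using n(3,4) m(1) mult_left_le[of n n] by (simp add: power2_eq_square divide_right_mono)
    finally have nv2: "(norm v)\<^sup>2 \<le> n / m\<^sup>2" .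
    have dN: "(N has_derivative (\<lambda>h. 2 * (v \<bullet> snd h) - form_deriv y v (fst h))) (at (y, \<eta>))"
      by (rule has_derivative_dual_norm_squared[OF N y v])
    have "(W has_derivative frechet_derivative W (at y)) (at y)"
      using smooth_on_differentiable[OF W(1) y] by (simp add: frechet_derivative_works)
    then have dW: "((\<lambda>z. W (fst z)) has_derivative (\<lambda>h. frechet_derivative W (at y) (fst h))) (at (y, \<eta>))"
      by (intro has_derivative_compose[where g = W and f = fst]) (auto intro!: derivative_eq_intros)
    have "B y v v + W y > 0"
      using nonneg[OF y, of v] W(2)[OF y] by linarith
    then have pos': "N (y, \<eta>) + W (fst (y, \<eta>)) > 0"
      unfolding N_def using Fz z by simp
    define D where "D h = (2 * (v \<bullet> snd h) - form_deriv y v (fst h) + frechet_derivative W (at y) (fst h))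
        / (2 * F z)" for h
    have "sqrt (N (y, \<eta>) + W (fst (y, \<eta>))) = F z"
      using Fs s unfolding N_def z by simp
    then have "((\<lambda>z. sqrt (N z + W (fst z))) has_derivative D) (at (y, \<eta>))"
      using has_derivative_real_sqrt[OF pos' has_derivative_add[OF dN dW]]
      unfolding D_def by (simp add: field_simps)
    moreover have "open (U \<times> (UNIV :: 'e set))"
      using open_dom by (simp add: open_Times)
    \<comment> \<open>The square root of the square gives back \<open>F\<close> because
      \<open>F\<close> is nonnegative over \<open>U\<close>.\<close>
    moreover have "sqrt (N x + W (fst x)) = F x" if x: "x \<in> U \<times> UNIV" for x
    proof -
      have "fst x \<in> U" using x by auto
      then have "F x \<ge> 0"
        using F[of x] nonneg[of "fst x"] W(2)[of "fst x"] by (auto intro: add_nonneg_nonneg less_imp_le)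
      then show ?thesis by (simp add: N_def)
    qed
    ultimately have "(F has_derivative D) (at z)"
      unfolding z using y by (auto intro: has_derivative_transform_within_open)
    then have fr: "frechet_derivative F (at z) = D"
      by (rule frechet_derivative_at[symmetric])
    have fd0: "form_deriv y v 0 = 0" "frechet_derivative W (at y) 0 = 0"
      using has_derivative_form[OF y, of v] \<open>(W has_derivative _) (at y)\<close>
      by (auto dest!: has_derivative_linear linear_0)
    have quot: "\<bar>x\<bar> / (2 * F z) \<le> C * n" if x: "\<bar>x\<bar> \<le> (1 / m + K / m\<^sup>2 + L) * n * 2" for x
    proof -
      have "\<bar>x\<bar> / (2 * F z) \<le> ((1 / m + K / m\<^sup>2 + L) * n * 2) / (2 * s)"
        using Fs s by (intro frac_le order_trans[OF abs_ge_zero x] x) auto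
      then show ?thesis unfolding C_def by simp
    qed
    \<comment> \<open>Naming the three products leaves only linear inequalities for the two
      components of the gradient.\<close>
    define p q r where "p = n / m" and "q = K * (n / m\<^sup>2)" and "r = L * n"
    have split: "(1 / m + K / m\<^sup>2 + L) * n * 2 = 2 * p + 2 * q + 2 * r"
      unfolding p_def q_def r_def by (simp add: algebra_simps)
    have t: "p \<ge> 0" "q \<ge> 0" "r \<ge> 0"
      using n(4) m(1) K(1) L(1) unfolding p_def q_def r_def by auto
    have "\<bar>v \<bullet> b\<bar> \<le> norm v"
      using b by (simp add: Basis_le_norm)
    then have "\<bar>2 * (v \<bullet> b)\<bar> \<le> (1 / m + K / m\<^sup>2 + L) * n * 2"
      using nv t unfolding split p_def[symmetric] by linarith
    from quot[OF this] have 1: "\<bar>D (0, b)\<bar> \<le> C * n"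
      using Fs s unfolding D_def by (simp add: fd0)
    have "\<bar>form_deriv y v b\<bar> \<le> q"
      using elim(1) mult_left_mono[OF nv2 K(1)] unfolding z q_def by (metis fst_conv order_trans)
    moreover have "\<bar>frechet_derivative W (at y) b\<bar> \<le> r"
      using elim(1) mult_left_mono[OF n(1) L(1)] unfolding z r_def by (metis fst_conv order_trans)
    ultimately have "\<bar>- form_deriv y v b + frechet_derivative W (at y) b\<bar> \<le> (1 / m + K / m\<^sup>2 + L) * n * 2"
      using t unfolding split by linarith
    from quot[OF this] have 2: "\<bar>D (b, 0)\<bar> \<le> C * n"
      using Fs s unfolding D_def by simp
    show ?case
      using 1 2 unfolding fr n_def by simp
  qed
  moreover have "C \<ge> 0"
    using m(1) K(1) L(1) s unfolding C_def by simp
  ultimately show ?thesis by blast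
qed

end

section \<open>Rest points of Hamiltonian flows\<close>

text \<open>Let \<open>M\<close> be the largest deviation from \<open>z\<^sub>0\<close> on a closed
  interval of radius \<open>e\<close> around \<open>t\<close>. The speed there is at most
  \<open>C * M\<close>, so the mean value theorem gives
  \<open>M \<le> C * M * e \<le> M / 2\<close>, hence \<open>M = 0\<close>. A bound on
  \<open>f\<close> centred at \<open>z\<^sub>0\<close> replaces a Lipschitz condition between
  arbitrary points.\<close>

lemma equilibrium_locally_unique:
  fixes z :: "real \<Rightarrow> 'a::real_normed_vector"
  assumes z: "\<forall>\<^sub>F s in nhds t. (z has_vector_derivative f (z s)) (at s)"
    and bound: "\<forall>\<^sub>F x in nhds z\<^sub>0. norm (f x) \<le> C * norm (x - z\<^sub>0)" and "C \<ge> 0"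
    and zt: "z t = z\<^sub>0"
  shows "\<forall>\<^sub>F s in nhds t. z s = z\<^sub>0"
proof -
  have "isCont z t"
    using eventually_nhds_x_imp_x[OF z] by (rule has_vector_derivative_continuous)
  then have "filterlim z (nhds z\<^sub>0) (nhds t)"
    using isCont_imp_tendsto_nhds zt by metis
  with bound have "\<forall>\<^sub>F s in nhds t. norm (f (z s)) \<le> C * norm (z s - z\<^sub>0)"
    unfolding filterlim_iff by blast
  with z have "\<forall>\<^sub>F s in nhds t. (z has_vector_derivative f (z s)) (at s) \<and>
      norm (f (z s)) \<le> C * norm (z s - z\<^sub>0)"
    by eventually_elim simp
  then obtain d where d: "d > 0" "\<And>s. dist s t < d \<Longrightarrow> (z has_vector_derivative f (z s)) (at s)"
    "\<And>s. dist s t < d \<Longrightarrow> norm (f (z s)) \<le> C * norm (z s - z\<^sub>0)"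
    unfolding eventually_nhds_metric by blast
  \<comment> \<open>Half of \<open>d\<close> keeps the closed ball inside the region of validity;
    \<open>C + 1\<close> gives \<open>C * e \<le> 1 / 2\<close> and covers
    \<open>C = 0\<close>.\<close>
  define e where "e = min (d / 2) (1 / (2 * (C + 1)))"
  have e: "e > 0" "e < d" "C * e \<le> 1 / 2"
  proof -
    show "e > 0" "e < d"
      using d(1) \<open>C \<ge> 0\<close> unfolding e_def by (auto simp: min_less_iff_disj)
    have "C * e \<le> C * (1 / (2 * (C + 1)))"
      using \<open>C \<ge> 0\<close> unfolding e_def by (intro mult_left_mono) auto
    also have "\<dots> \<le> 1 / 2"
      using \<open>C \<ge> 0\<close> by (simp add: field_simps)
    finally show "C * e \<le> 1 / 2" .
  qed
  have der: "(z has_vector_derivative f (z s)) (at s)" if "s \<in> cball t e" for s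
    using that e(2) by (intro d(2)) (auto simp: dist_commute)
  have "continuous_on (cball t e) (\<lambda>s. norm (z s - z\<^sub>0))"
    using der by (intro continuous_intros continuous_at_imp_continuous_on ballI)
      (blast intro: has_vector_derivative_continuous)
  moreover have "compact (cball t e)" "cball t e \<noteq> {}"
    using e(1) by auto
  ultimately obtain u where u: "u \<in> cball t e"
    "\<And>s. s \<in> cball t e \<Longrightarrow> norm (z s - z\<^sub>0) \<le> norm (z u - z\<^sub>0)"
    using continuous_attains_sup by metis
  define M where "M = norm (z u - z\<^sub>0)"
  have "norm (z u - z t) \<le> C * M * norm (u - t)"
  proof (rule differentiable_bound[where S = "cball t e" and f' = "\<lambda>s h. h *\<^sub>R f (z s)"])
    fix s assume s: "s \<in> cball t e"
    show "(z has_derivative (\<lambda>h. h *\<^sub>R f (z s))) (at s within cball t e)"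
      using der[OF s] unfolding has_vector_derivative_def by (rule has_derivative_at_withinI)
    have "norm (f (z s)) \<le> C * norm (z s - z\<^sub>0)"
      using s e(2) by (intro d(3)) (auto simp: dist_commute)
    also have "\<dots> \<le> C * M"
      using u(2)[OF s] \<open>C \<ge> 0\<close> unfolding M_def by (rule mult_left_mono)
    finally show "onorm (\<lambda>h. h *\<^sub>R f (z s)) \<le> C * M"
      by (simp add: onorm_scaleR_left onorm_id)
  qed (use u e(1) in auto)
  also have "\<dots> \<le> C * M * e"
    using u(1) \<open>C \<ge> 0\<close> unfolding M_def by (intro mult_left_mono) (auto simp: dist_norm norm_minus_commute)
  also have "\<dots> \<le> M / 2"
    using mult_right_mono[OF e(3), of M] unfolding M_def by (simp add: mult_ac)
  finally have "M \<le> 0"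
    unfolding zt M_def by simp
  then have "z s = z\<^sub>0" if "dist s t < e" for s
    using u(2)[of s] that unfolding M_def by (simp add: dist_commute)
  then show ?thesis
    unfolding eventually_nhds_metric using e(1) by blast
qed

section \<open>Tangent vectors in charts\<close>

context smooth_manifold
begin

lemma charts_atD: "c \<in> charts_at A p \<Longrightarrow> c \<in> A" "c \<in> charts_at A p \<Longrightarrow> p \<in> fst c"
  by (simp_all add: charts_at_def)

lemma chart_inj: "c \<in> A \<Longrightarrow> inj_on (snd c) (fst c)"
  using homeomorphic_imp_injective_map[OF chart_homeomorphism] openin_subset[OF chart_domain_open]
  by (simp add: inf.absorb2)

lemma chart_inv_chart: "c \<in> charts_at A p \<Longrightarrow> chart_inv c (snd c p) = p"
  by (simp add: charts_atD chart_inj)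

lemma chart_image_overlap_open:
  assumes "c \<in> A" "c' \<in> A"
  shows "open (snd c ` (fst c \<inter> fst c'))"
proof -
  have "openin (subtopology X (fst c)) (fst c \<inter> fst c')"
    using assms by (simp add: chart_domain_open openin_Int openin_subtopology_Int2)
  then have "openin (top_of_set (chart_image c)) (snd c ` (fst c \<inter> fst c'))"
    using homeomorphic_imp_open_map[OF chart_homeomorphism[OF assms(1)]]
    unfolding open_map_def by blast
  then show ?thesis
    using chart_image_open[OF assms(1)] openin_open_trans by blast
qed

lemma has_derivative_transition:
  assumes "c \<in> charts_at A p" "c' \<in> charts_at A p"
  shows "((snd c' \<circ> chart_inv c) has_derivative transition_diff c c' p) (at (snd c p))"
proof -
  have "(snd c' \<circ> chart_inv c) differentiable (at (snd c p))"
    using assms by (intro smooth_on_differentiable[OF smooth_transition]) (auto dest: charts_atD)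
  then show ?thesis
    by (simp add: transition_diff_def frechet_derivative_works)
qed

lemma linear_transition_diff:
  "c \<in> charts_at A p \<Longrightarrow> c' \<in> charts_at A p \<Longrightarrow> linear (transition_diff c c' p)"
  by (rule has_derivative_linear[OF has_derivative_transition])

lemma transition_diff_self:
  assumes "c \<in> charts_at A p"
  shows "transition_diff c c p w = w"
proof -
  have "((\<lambda>x. x) has_derivative transition_diff c c p) (at (snd c p))"
    using assms
    by (intro has_derivative_transform_within_open[OF has_derivative_transition chart_image_open])
      (auto dest: charts_atD simp: f_inv_into_f)
  then show ?thesis
    using has_derivative_unique[OF has_derivative_ident] by metis
qed

text \<open>The cocycle identity, from the chain rule: on the open image of the overlap of
  \<open>c\<close> and \<open>c'\<close> the composed transitions agree with the direct one, and
  derivatives are unique.\<close>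

lemma transition_diff_trans:
  assumes c: "c \<in> charts_at A p" "c' \<in> charts_at A p" "c'' \<in> charts_at A p"
  shows "transition_diff c' c'' p (transition_diff c c' p w) = transition_diff c c'' p w"
proof -
  have "((snd c'' \<circ> chart_inv c') has_derivative transition_diff c' c'' p)
      (at ((snd c' \<circ> chart_inv c) (snd c p)))"
    using has_derivative_transition[OF c(2,3)] chart_inv_chart[OF c(1)] by simp
  then have "((snd c'' \<circ> chart_inv c') \<circ> (snd c' \<circ> chart_inv c) has_derivative
      transition_diff c' c'' p \<circ> transition_diff c c' p) (at (snd c p))"
    by (rule diff_chain_at[OF has_derivative_transition[OF c(1,2)]])
  moreover have "open (snd c ` (fst c \<inter> fst c'))"
    using c by (simp add: chart_image_overlap_open charts_atD)
  moreover have "snd c p \<in> snd c ` (fst c \<inter> fst c')"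
    using c by (simp add: charts_atD)
  ultimately have "(snd c'' \<circ> chart_inv c has_derivative
      transition_diff c' c'' p \<circ> transition_diff c c' p) (at (snd c p))"
  proof (rule has_derivative_transform_within_open)
    fix x assume "x \<in> snd c ` (fst c \<inter> fst c')"
    then obtain u where u: "x = snd c u" "u \<in> fst c" "u \<in> fst c'" by blast
    show "((snd c'' \<circ> chart_inv c') \<circ> (snd c' \<circ> chart_inv c)) x = (snd c'' \<circ> chart_inv c) x"
      using c u by (simp add: chart_inj charts_atD)
  qed
  from has_derivative_unique[OF this has_derivative_transition[OF c(1,3)]]
  show ?thesis by (metis comp_apply)
qed

lemma chart_vector_in_tangent_space:
  "c \<in> charts_at A p \<Longrightarrow> chart_vector A c p w \<in> tangent_space A p"
  by (auto simp: tangent_space_def chart_vector_def transition_diff_trans)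

lemma chart_vector_apply: "c \<in> charts_at A p \<Longrightarrow> chart_vector A c p w c = w"
  by (simp add: chart_vector_def transition_diff_self)

text \<open>Together with \<open>chart_vector_apply\<close> this makes evaluation at
  \<open>c\<close> a bijection from the tangent space onto the coordinate space.\<close>

lemma chart_vector_of_tangent:
  assumes "c \<in> charts_at A p" "v \<in> tangent_space A p"
  shows "chart_vector A c p (v c) = v"
proof
  fix c'
  show "chart_vector A c p (v c) c' = v c'"
  proof (cases "c' \<in> charts_at A p")
    case True
    then have "v c' = transition_diff c c' p (v c)"
      using assms unfolding tangent_space_def by blast
    then show ?thesis
      using True by (simp add: chart_vector_def)
  next
    case False
    moreover have "v c' = 0"
      using False assms(2) unfolding tangent_space_def by blast
    ultimately show ?thesis
      by (simp add: chart_vector_def)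
  qed
qed

lemma chart_vector_add:
  "c \<in> charts_at A p \<Longrightarrow>
    chart_vector A c p (a + b) = (\<lambda>c'. chart_vector A c p a c' + chart_vector A c p b c')"
  by (auto simp: chart_vector_def linear_add[OF linear_transition_diff])

lemma chart_vector_scale:
  "c \<in> charts_at A p \<Longrightarrow> chart_vector A c p (r *\<^sub>R a) = (\<lambda>c'. r *\<^sub>R chart_vector A c p a c')"
  by (auto simp: chart_vector_def linear_cmul[OF linear_transition_diff])

section \<open>The zero section and integral curves at a rest point\<close>

lemma zero_in_cotangent_bundle: "p \<in> topspace X \<Longrightarrow> (p, \<lambda>_. 0) \<in> cotangent_bundle X A"
  by (simp add: cotangent_bundle_def cotangent_space_def)

lemma canonical_coords_zero: "canonical_coords A c (p, \<lambda>_. 0) = (snd c p, 0)"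
  by (simp add: canonical_coords_def)

text \<open>Brings statements about coordinates back to the bundle. Injectivity of the chart fixes
  the base point; a covector that vanishes on the coordinate vectors vanishes on their span, the
  whole tangent space.\<close>

lemma canonical_coords_eq_zeroD:
  assumes c: "c \<in> charts_at A p" "c \<in> charts_at A (fst \<rho>)" and \<rho>: "\<rho> \<in> cotangent_bundle X A"
    and eq: "canonical_coords A c \<rho> = (snd c p, 0)"
  shows "\<rho> = (p, \<lambda>_. 0)"
proof -
  have "snd c (fst \<rho>) = snd c p"
    using eq by (simp add: canonical_coords_def)
  then have p: "fst \<rho> = p"
    using chart_inv_chart[OF c(1)] chart_inv_chart[OF c(2)] by simp
  obtain \<xi> where \<rho>_eq: "\<rho> = (p, \<xi>)" using p by (cases \<rho>) auto
  have \<xi>: "\<xi> \<in> cotangent_space A p"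
    using \<rho> by (simp add: \<rho>_eq cotangent_bundle_def)
  define f where "f a = \<xi> (chart_vector A c p a)" for a
  have "linear f"
    using \<xi> c(1) chart_vector_in_tangent_space[OF c(1)]
    by (intro linearI) (auto simp: f_def chart_vector_add chart_vector_scale cotangent_space_def)
  moreover have "f b = 0" if "b \<in> Basis" for b
  proof -
    have "(\<Sum>b\<in>Basis. f b *\<^sub>R b) \<bullet> b = 0"
      using eq by (simp add: canonical_coords_def f_def \<rho>_eq)
    then show ?thesis
      using that by (simp add: inner_sum_left_Basis)
  qed
  ultimately have f0: "f a = 0" for a
    using linear_eq_stdbasis[of f "\<lambda>_. 0"] by (metis linear_zero)
  have "\<xi> v = 0" for v
  proof (cases "v \<in> tangent_space A p")
    case True
    then show ?thesis
      using f0[of "v c"] chart_vector_of_tangent[OF c(1)] by (simp add: f_def)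
  next
    case False
    then show ?thesis using \<xi> by (simp add: cotangent_space_def)
  qed
  then show ?thesis by (auto simp: \<rho>_eq)
qed

text \<open>The interval is connected, and the times at the rest point and those away from it both
  form open sets: the first by local uniqueness in a chart, the second by continuity.\<close>

lemma hamiltonian_curve_through_rest_point:
  assumes p: "p \<in> topspace X"
    and bound: "\<And>c. c \<in> charts_at A p \<Longrightarrow> \<exists>C\<ge>0. \<forall>\<^sub>F z in nhds (snd c p, 0).
        norm (hamiltonian_field A k c z) \<le> C * norm (z - (snd c p, 0))"
    and \<gamma>: "hamiltonian_curve X A k I \<gamma>"
    and I: "open I" "is_interval I" "0 \<in> I" and \<gamma>0: "\<gamma> 0 = (p, \<lambda>_. 0)" and t: "t \<in> I"
  shows "\<gamma> t = (p, \<lambda>_. 0)"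
proof -
  define \<rho> :: "('m, 'e) cotangent" where "\<rho> = (p, \<lambda>_. 0)"
  have mem: "\<gamma> s \<in> cotangent_bundle X A" if "s \<in> I" for s
    using \<gamma> that unfolding hamiltonian_curve_def by auto
  have ev_base: "\<forall>\<^sub>F s in nhds t. s \<in> I \<and> fst (\<gamma> s) \<in> W"
    if "t \<in> I" "openin X W" "fst (\<gamma> t) \<in> W" for t W
  proof -
    have "openin (top_of_set I) {s \<in> topspace (top_of_set I). (fst \<circ> \<gamma>) s \<in> W}"
      using \<gamma> that(2) unfolding hamiltonian_curve_def by (blast intro: openin_continuous_map_preimage)
    then have "open {s \<in> I. fst (\<gamma> s) \<in> W}"
      using I(1) openin_open_eq by auto
    from eventually_nhds_in_open[OF this, of t] show ?thesis
      using that by simp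
  qed
  have ev_chart: "\<forall>\<^sub>F s in nhds t. s \<in> I \<and> c \<in> charts_at A (fst (\<gamma> s))"
    if "t \<in> I" "c \<in> charts_at A (fst (\<gamma> t))" for t c
    using ev_base[of t "fst c"] that chart_domain_open by (simp add: charts_at_def)
  have der: "((\<lambda>s. canonical_coords A c (\<gamma> s)) has_vector_derivative
      hamiltonian_field A k c (canonical_coords A c (\<gamma> t))) (at t)"
    if "t \<in> I" "c \<in> charts_at A (fst (\<gamma> t))" for t c
    using \<gamma> that unfolding hamiltonian_curve_def by blast
  obtain c where c: "c \<in> charts_at A p"
    using p cover by (auto simp: charts_at_def)
  have "open {s \<in> I. \<gamma> s = \<rho>}"
    unfolding open_subopen[of "{s \<in> I. \<gamma> s = \<rho>}"]
  proof
    fix s assume s: "s \<in> {s \<in> I. \<gamma> s = \<rho>}"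
    then have c': "c \<in> charts_at A (fst (\<gamma> s))"
      using c by (simp add: \<rho>_def)
    obtain C where C: "C \<ge> 0" "\<forall>\<^sub>F z in nhds (snd c p, 0).
        norm (hamiltonian_field A k c z) \<le> C * norm (z - (snd c p, 0))"
      using bound[OF c] by blast
    \<comment> \<open>Local uniqueness asks for the differential equation at all nearby times, so
      the base curve is first kept inside the domain of \<open>c\<close>.\<close>
    have "\<forall>\<^sub>F s in nhds s. s \<in> I \<and> c \<in> charts_at A (fst (\<gamma> s))"
      using ev_chart s c' by simp
    moreover from this have "\<forall>\<^sub>F s in nhds s. ((\<lambda>s. canonical_coords A c (\<gamma> s)) has_vector_derivative
        hamiltonian_field A k c (canonical_coords A c (\<gamma> s))) (at s)"
      by (rule eventually_mono) (simp add: der)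
    then have "\<forall>\<^sub>F s in nhds s. canonical_coords A c (\<gamma> s) = (snd c p, 0)"
      by (rule equilibrium_locally_unique[OF _ C(2,1)])
        (use s in \<open>simp add: \<rho>_def canonical_coords_zero\<close>)
    ultimately have "\<forall>\<^sub>F s in nhds s. s \<in> I \<and> \<gamma> s = \<rho>"
      by eventually_elim (use c mem canonical_coords_eq_zeroD in \<open>auto simp: \<rho>_def\<close>)
    then show "\<exists>T. open T \<and> s \<in> T \<and> T \<subseteq> {s \<in> I. \<gamma> s = \<rho>}"
      unfolding eventually_nhds by blast
  qed
  moreover have "open {s \<in> I. \<gamma> s \<noteq> \<rho>}"
    unfolding open_subopen[of "{s \<in> I. \<gamma> s \<noteq> \<rho>}"]
  proof
    fix s assume s: "s \<in> {s \<in> I. \<gamma> s \<noteq> \<rho>}"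
    have "\<forall>\<^sub>F s in nhds s. s \<in> I \<and> \<gamma> s \<noteq> \<rho>"
    \<comment> \<open>If the base point differs, the complement of the closed set \<open>{p}\<close>
      captures nearby times. If only the covector differs, the coordinates in \<open>c\<close>
      differ, and their continuity suffices.\<close>
    proof (cases "fst (\<gamma> s) = p")
      case False
      have "closedin X {p}"
        using Hausdorff p by (simp add: closedin_Hausdorff_singleton)
      then have "openin X (topspace X - {p})" by blast
      moreover have "fst (\<gamma> s) \<in> topspace X"
        using mem[of s] s by (auto simp: cotangent_bundle_def)
      ultimately have "\<forall>\<^sub>F s in nhds s. s \<in> I \<and> fst (\<gamma> s) \<in> topspace X - {p}"
        using False s by (intro ev_base) auto
      then show ?thesis
        by (rule eventually_mono) (auto simp: \<rho>_def)
    next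
      case True
      then have c': "c \<in> charts_at A (fst (\<gamma> s))"
        using c by simp
      have "isCont (\<lambda>s. canonical_coords A c (\<gamma> s)) s"
        using der s c' by (blast intro: has_vector_derivative_continuous)
      moreover have "canonical_coords A c (\<gamma> s) \<noteq> (snd c p, 0)"
        using canonical_coords_eq_zeroD[OF c c' mem] s by (auto simp: \<rho>_def)
      ultimately have "\<forall>\<^sub>F s in nhds s. canonical_coords A c (\<gamma> s) \<in> - {(snd c p, 0)}"
        by (intro topological_tendstoD[OF isCont_imp_tendsto_nhds]) auto
      moreover have "\<forall>\<^sub>F s in nhds s. s \<in> I"
        using I(1) s by (simp add: eventually_nhds_in_open)
      ultimately show ?thesis
        by eventually_elim (auto simp: \<rho>_def canonical_coords_zero)
    qed
    then show "\<exists>T. open T \<and> s \<in> T \<and> T \<subseteq> {s \<in> I. \<gamma> s \<noteq> \<rho>}"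
      unfolding eventually_nhds by blast
  qed
  ultimately have "{s \<in> I. \<gamma> s = \<rho>} \<inter> I = {} \<or> {s \<in> I. \<gamma> s \<noteq> \<rho>} \<inter> I = {}"
    using is_interval_connected[OF I(2)] by (intro connectedD) auto
  then show ?thesis
    using I(3) \<gamma>0 t unfolding \<rho>_def by blast
qed

text \<open>The flow is a definite description: the constant curve on the whole line provides the
  value, and the preceding lemma excludes any other.\<close>

lemma hamiltonian_flow_rest_point:
  assumes p: "p \<in> topspace X"
    and bound: "\<And>c. c \<in> charts_at A p \<Longrightarrow> \<exists>C\<ge>0. \<forall>\<^sub>F z in nhds (snd c p, 0).
        norm (hamiltonian_field A k c z) \<le> C * norm (z - (snd c p, 0))"
  shows "hamiltonian_flow X A k t (p, \<lambda>_. 0) = (p, \<lambda>_. 0)"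
proof -
  \<comment> \<open>The estimate holds at the centre too, where its right-hand side is 0.\<close>
  have "hamiltonian_field A k c (snd c p, 0) = 0" if c: "c \<in> charts_at A p" for c
  proof -
    obtain C where "\<forall>\<^sub>F z in nhds (snd c p, 0). norm (hamiltonian_field A k c z) \<le> C * norm (z - (snd c p, 0))"
      using bound[OF c] by blast
    from eventually_nhds_x_imp_x[OF this] show ?thesis by simp
  qed
  then have const: "hamiltonian_curve X A k UNIV (\<lambda>_. (p, \<lambda>_. 0))"
    using p by (auto simp: hamiltonian_curve_def canonical_coords_zero comp_def zero_in_cotangent_bundle)
  show ?thesis
    unfolding hamiltonian_flow_def
  proof (rule the_equality)
    show "\<exists>I \<gamma>. open I \<and> is_interval I \<and> 0 \<in> I \<and> t \<in> I \<and> hamiltonian_curve X A k I \<gamma> \<and>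
        \<gamma> 0 = (p, \<lambda>_. 0) \<and> \<gamma> t = (p, \<lambda>_. 0)"
      using const is_interval_univ by blast
  next
    fix \<sigma>
    assume "\<exists>I \<gamma>. open I \<and> is_interval I \<and> 0 \<in> I \<and> t \<in> I \<and> hamiltonian_curve X A k I \<gamma> \<and>
        \<gamma> 0 = (p, \<lambda>_. 0) \<and> \<gamma> t = \<sigma>"
    then obtain I \<gamma> where "hamiltonian_curve X A k I \<gamma>" "open I" "is_interval I" "0 \<in> I"
      "\<gamma> 0 = (p, \<lambda>_. 0)" "t \<in> I" "\<gamma> t = \<sigma>" by blast
    then show "\<sigma> = (p, \<lambda>_. 0)"
      using hamiltonian_curve_through_rest_point[OF p bound] by blast
  qed
qed

end

section \<open>The symbol \<open>q\<close> near a critical point of the potential\<close>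

context riemannian_manifold
begin

definition chart_metric :: "('m, 'e) chart \<Rightarrow> 'e \<Rightarrow> 'e \<Rightarrow> 'e \<Rightarrow> real" where
  "chart_metric c y a b = g (chart_inv c y) (chart_vector A c (chart_inv c y) a)
                                            (chart_vector A c (chart_inv c y) b)"

lemma chart_inv_in:
  assumes "c \<in> A" "y \<in> chart_image c"
  shows "chart_inv c y \<in> topspace X" "c \<in> charts_at A (chart_inv c y)"
  using inv_into_into[OF assms(2)] assms(1) openin_subset[OF chart_domain_open[OF assms(1)]]
  by (auto simp: charts_at_def)

lemma smooth_metric_chart:
  assumes c: "c \<in> A"
  shows "smooth_metric (chart_image c) (chart_metric c)"
proof
  fix y assume y: "y \<in> chart_image c"
  note p = chart_inv_in[OF c y]
  note tan = chart_vector_in_tangent_space[OF p(2)]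
  show comm: "chart_metric c y a b = chart_metric c y b a" for a b
    unfolding chart_metric_def by (rule metric_commute[OF p(1) tan tan])
  have l: "linear (\<lambda>a. chart_metric c y a b)" for b
    by (rule linearI) (simp_all add: chart_metric_def chart_vector_add chart_vector_scale
        metric_add metric_scale p tan)
  then show "bilinear (chart_metric c y)"
    using comm unfolding bilinear_def by simp
  show "chart_metric c y a a > 0" if "a \<noteq> 0" for a
    unfolding chart_metric_def
  proof (rule metric_pos[OF p(1) tan])
    show "chart_vector A c (chart_inv c y) a \<noteq> (\<lambda>_. 0)"
      using that chart_vector_apply[OF p(2), of a] by metis
  qed
next
  show "open (chart_image c)"
    by (rule chart_image_open[OF c])
  show "smooth_on (chart_image c) (\<lambda>y. chart_metric c y i j)" if "i \<in> Basis" "j \<in> Basis" for i j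
    unfolding chart_metric_def using metric_smooth[OF c that] .
qed

text \<open>The sharp of a covector is the chart vector of its dual coordinate vector
  \<open>v\<close>, so the squared covector norm is \<open>chart_metric\<close> at \<open>v\<close>.
  This is the shape that \<open>energy_gradient_bound\<close> expects.\<close>

lemma symbol_q_chart:
  assumes c: "c \<in> A" and z: "fst z \<in> chart_image c"
  shows "\<exists>v. (\<forall>w. chart_metric c (fst z) v w = snd z \<bullet> w) \<and>
    (symbol_q A g V \<circ> canonical_coords_inv A c) z =
      sqrt (chart_metric c (fst z) v v + (V \<circ> chart_inv c) (fst z))"
proof -
  interpret M: smooth_metric "chart_image c" "chart_metric c"
    by (rule smooth_metric_chart[OF c])
  define p where "p = chart_inv c (fst z)"
  have p: "p \<in> topspace X" "c \<in> charts_at A p"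
    using chart_inv_in[OF c z] by (simp_all add: p_def)
  note tan = chart_vector_in_tangent_space[OF p(2)]
  define \<xi> where "\<xi> v = (if v \<in> tangent_space A p then snd z \<bullet> v c else 0)" for v
  obtain v where v: "\<And>w. chart_metric c (fst z) v w = snd z \<bullet> w"
    using M.ex_dual[OF z] by blast
  have cm: "chart_metric c (fst z) a b = g p (chart_vector A c p a) (chart_vector A c p b)" for a b
    by (simp add: chart_metric_def p_def)
  have "sharp A g (p, \<xi>) = chart_vector A c p v"
    unfolding sharp_def fst_conv snd_conv
  proof (rule the_equality, intro conjI ballI)
    show "chart_vector A c p v \<in> tangent_space A p" by (rule tan)
    fix w assume w: "w \<in> tangent_space A p"
    show "g p (chart_vector A c p v) w = \<xi> w"
      using cm[of v "w c"] v[of "w c"] w by (simp add: \<xi>_def chart_vector_of_tangent[OF p(2) w])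
  next
    fix u
    assume u: "u \<in> tangent_space A p \<and> (\<forall>w\<in>tangent_space A p. g p u w = \<xi> w)"
    \<comment> \<open>Two dual vectors pair equally with every \<open>w\<close>; taking
      \<open>w\<close> to be their difference, positivity makes them equal.\<close>
    have "chart_metric c (fst z) (u c) w = chart_metric c (fst z) v w" for w
      using u by (simp add: v) (simp add: cm chart_vector_of_tangent[OF p(2)] tan \<xi>_def chart_vector_apply[OF p(2)])
    then have "chart_metric c (fst z) (u c - v) (u c - v) = 0"
      by (simp add: bilinear_lsub[OF M.bilinear[OF z]])
    then have "u c = v"
      using M.pos[OF z, of "u c - v"] by fastforce
    then show "u = chart_vector A c p v"
      using chart_vector_of_tangent[OF p(2)] u by metis
  qed
  then have cov: "covector_norm A g (p, \<xi>) = sqrt (chart_metric c (fst z) v v)"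
    by (simp add: covector_norm_def cm)
  have "chart_metric c (fst z) v v \<ge> 0"
    using M.pos[OF z, of v] bilinear_lzero[OF M.bilinear[OF z]] by (cases "v = 0") auto
  moreover have "canonical_coords_inv A c z = (p, \<xi>)"
    by (auto simp: canonical_coords_inv_def Let_def p_def \<xi>_def)
  ultimately have "(symbol_q A g V \<circ> canonical_coords_inv A c) z =
      sqrt (chart_metric c (fst z) v v + (V \<circ> chart_inv c) (fst z))"
    by (simp add: symbol_q_def cov) (simp add: p_def)
  then show ?thesis using v by blast
qed

text \<open>The components of the field are, up to sign, the partial derivatives of \<open>q\<close>
  in the chart, which are bounded one basis direction at a time and then summed.\<close>

lemma hamiltonian_field_bound_at_critical_point:
  assumes V: "smooth_fun A V" "\<And>x. x \<in> topspace X \<Longrightarrow> V x > 0" "critical_point A V p"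
    and c: "c \<in> charts_at A p"
  shows "\<exists>C\<ge>0. \<forall>\<^sub>F z in nhds (snd c p, 0).
    norm (hamiltonian_field A (symbol_q A g V) c z) \<le> C * norm (z - (snd c p, 0))"
proof -
  note cA = charts_atD(1)[OF c]
  interpret M: smooth_metric "chart_image c" "chart_metric c"
    by (rule smooth_metric_chart[OF cA])
  define F where "F = symbol_q A g V \<circ> canonical_coords_inv A c"
  define D where "D z = frechet_derivative F (at z)" for z
  have "\<forall>b\<in>Basis. \<exists>C\<ge>0. \<forall>\<^sub>F z in nhds (snd c p, 0).
      \<bar>D z (0, b)\<bar> \<le> C * norm (z - (snd c p, 0)) \<and> \<bar>D z (b, 0)\<bar> \<le> C * norm (z - (snd c p, 0))"
    unfolding D_def
  proof (rule ballI, rule M.energy_gradient_bound[where W = "V \<circ> chart_inv c"])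
    show "\<exists>v. (\<forall>w. chart_metric c (fst z) v w = snd z \<bullet> w) \<and>
        F z = sqrt (chart_metric c (fst z) v v + (V \<circ> chart_inv c) (fst z))"
      if "fst z \<in> chart_image c" for z
      unfolding F_def by (rule symbol_q_chart[OF cA that])
    show "smooth_on (chart_image c) (V \<circ> chart_inv c)"
      using V(1) cA by (simp add: smooth_fun_def)
    show "(V \<circ> chart_inv c) y > 0" if "y \<in> chart_image c" for y
      using V(2) chart_inv_in(1)[OF cA that] by simp
    show "snd c p \<in> chart_image c"
      using charts_atD(2)[OF c] by simp
    show "(V \<circ> chart_inv c has_derivative (\<lambda>_. 0)) (at (snd c p))"
      using V(3) c by (simp add: critical_point_def)
  qed
  from bchoice[OF this] obtain K where K: "\<forall>b\<in>Basis. K b \<ge> 0 \<and>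
      (\<forall>\<^sub>F z in nhds (snd c p, 0). \<bar>D z (0, b)\<bar> \<le> K b * norm (z - (snd c p, 0)) \<and>
        \<bar>D z (b, 0)\<bar> \<le> K b * norm (z - (snd c p, 0)))"
    by auto
  \<comment> \<open>Bounds the position part and the momentum part separately; the norm of the pair
    is at most the sum of both, whence \<open>2 * C\<close> below.\<close>
  define C where "C = (\<Sum>b\<in>Basis. K b)"
  have "\<forall>\<^sub>F z in nhds (snd c p, 0). \<forall>b\<in>Basis.
      \<bar>D z (0, b)\<bar> \<le> K b * norm (z - (snd c p, 0)) \<and> \<bar>D z (b, 0)\<bar> \<le> K b * norm (z - (snd c p, 0))"
    using K by (intro eventually_ball_finite) auto
  then have "\<forall>\<^sub>F z in nhds (snd c p, 0).
      norm (hamiltonian_field A (symbol_q A g V) c z) \<le> (2 * C) * norm (z - (snd c p, 0))"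
  proof (rule eventually_mono)
    fix z
    assume z: "\<forall>b\<in>Basis. \<bar>D z (0, b)\<bar> \<le> K b * norm (z - (snd c p, 0)) \<and>
        \<bar>D z (b, 0)\<bar> \<le> K b * norm (z - (snd c p, 0))"
    have H: "hamiltonian_field A (symbol_q A g V) c z =
        (\<Sum>b\<in>Basis. D z (0, b) *\<^sub>R b, - (\<Sum>b\<in>Basis. D z (b, 0) *\<^sub>R b))"
      by (simp add: hamiltonian_field_def Let_def D_def F_def)
    have sum: "norm (\<Sum>b\<in>Basis. f b *\<^sub>R b) \<le> C * norm (z - (snd c p, 0))"
      if "\<And>b. b \<in> Basis \<Longrightarrow> \<bar>f b\<bar> \<le> K b * norm (z - (snd c p, 0))" for f :: "'e \<Rightarrow> real"
      unfolding C_def sum_distrib_right using that by (intro sum_norm_le) simp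
    have "norm (hamiltonian_field A (symbol_q A g V) c z) \<le>
        norm (\<Sum>b\<in>Basis. D z (0, b) *\<^sub>R b) + norm (\<Sum>b\<in>Basis. D z (b, 0) *\<^sub>R b)"
      unfolding H by (rule order_trans[OF norm_Pair_le]) simp
    also have "\<dots> \<le> C * norm (z - (snd c p, 0)) + C * norm (z - (snd c p, 0))"
      by (rule add_mono[OF sum sum]) (use z in auto)
    finally show "norm (hamiltonian_field A (symbol_q A g V) c z) \<le> (2 * C) * norm (z - (snd c p, 0))"
      by simp
  qed
  moreover have "2 * C \<ge> 0"
    unfolding C_def using K by (simp add: sum_nonneg)
  ultimately show ?thesis by blast
qed

end

theorem lemma1p10:
  fixes X :: "'m topology"
    and A :: "('m, 'e::euclidean_space) chart set"
    and g :: "'m \<Rightarrow> ('m, 'e) tvec \<Rightarrow> ('m, 'e) tvec \<Rightarrow> real"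
    and V :: "'m \<Rightarrow> real"
    and \<omega> :: "'m set"
    and x\<^sub>0 :: 'm
  assumes "riemannian_manifold X A g"
    and "compact_space X"
    and "connected_space X"
    and "openin X \<omega>"
    and "smooth_fun A V"
    and "\<And>x. x \<in> topspace X \<Longrightarrow> V x > 0"
    and "Linf_norm X A V = 1"
    and "x\<^sub>0 \<in> topspace X"
    and "critical_point A V x\<^sub>0"
    and "x\<^sub>0 \<notin> \<omega>"
  shows "\<forall>T>0. \<not> GCC X A g V \<omega> T"
proof -
  interpret riemannian_manifold X A g by fact
  have "hamiltonian_flow X A (symbol_q A g V) t (x\<^sub>0, \<lambda>_. 0) = (x\<^sub>0, \<lambda>_. 0)" for t
    using assms(8) hamiltonian_field_bound_at_critical_point[OF assms(5,6,9)]
    by (rule hamiltonian_flow_rest_point)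
  \<comment> \<open>Valid for every \<open>t\<close>, so one covector refutes the condition for all
    \<open>T\<close> at once.\<close>
  then have "fst (hamiltonian_flow X A (symbol_q A g V) t (x\<^sub>0, \<lambda>_. 0)) \<notin> \<omega>" for t
    using assms(10) by simp
  then show ?thesis
    using zero_in_cotangent_bundle[OF assms(8)] unfolding GCC_def by blast
qed

end
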